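(* As $n\to\infty$, $$f_B(n)\le (2+o(1))\sqrt{n},$$ where $f_B(n)$ is the minimum of $t(G)$ over all connected bipartite graphs $G$ on $n$ vertices, and $t(G)$ is the maximum number of vertices of an induced subgraph of $G$ that is a tree.
   Context: All graphs are finite, simple and undirected. For a graph $G$, $t(G)$ denotes the maximum number of vertices of an induced subgraph of $G$ that is a tree (i.e., connected and acyclic). For a positive integer $n$, $f_B(n)=\min\{t(G) : |V(G)|=n,\ G \text{ connected and bipartite}\}$. *)

theory Defs
  imports
    "HOL-Library.Landau_Symbols"
    "Graph_Theory.Graph_Theory"
begin

text \<open>
  A finite simple undirected graph is a finite, loop-free, symmetric digraph without parallel
  arcs (locale \<open>graph\<close>, or \<open>pair_graph\<close> when arcs are ordered pairs of vertices). The library's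
  \<open>tree\<close> is not usable for such graphs: it counts the closed walk a, b, a along a single edge as a
  cycle. In a simple symmetric digraph the library cycles of length at least 3 are exactly the
  cycles of the undirected graph.
\<close>

definition acyclic_graph :: "('a, 'b) pre_digraph \<Rightarrow> bool" where
  "acyclic_graph G \<longleftrightarrow> \<not> (\<exists>p. pre_digraph.cycle G p \<and> 3 \<le> length p)"

text \<open>\<open>Digraph_Component.connected\<close> requires at least one vertex.\<close>

definition tree_graph :: "('a, 'b) pre_digraph \<Rightarrow> bool" where
  "tree_graph G \<longleftrightarrow> Digraph_Component.connected G \<and> acyclic_graph G"

definition bipartite :: "('a, 'b) pre_digraph \<Rightarrow> bool" where
  "bipartite G \<longleftrightarrow> (\<exists>A B. A \<union> B = verts G \<and> A \<inter> B = {} \<and>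
     (\<forall>e \<in> arcs G. tail G e \<in> A \<and> head G e \<in> B \<or> tail G e \<in> B \<and> head G e \<in> A))"

definition max_induced_tree :: "('a, 'b) pre_digraph \<Rightarrow> nat" where
  "max_induced_tree G = Max {card (verts H) | H. induced_subgraph H G \<and> tree_graph H}"

text \<open>
  Vertices are taken to be natural numbers, which loses no generality: every finite graph is
  isomorphic to such a graph. The set below is finite, since all its elements are at most
  \<open>n\<close>, and nonempty for \<open>n \<ge> 1\<close>; \<open>f_B 0\<close> is irrelevant.
\<close>

definition f_B :: "nat \<Rightarrow> nat" where
  "f_B n = Min {max_induced_tree (with_proj G) | G :: nat pair_pre_digraph.
     pair_graph G \<and> card (pverts G) = n \<and>
     Digraph_Component.connected (with_proj G) \<and> bipartite (with_proj G)}"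

end

(*
  Let n <= k^2 and place the vertices on the cells of a k x k board. Join two cells whenever their
  antidiagonals are adjacent: this is a blow-up of a path, with classes of sizes 1, 2, ..., k, ..., 2, 1.
  If a connected induced subgraph has two vertices in a level lying strictly between its lowest and
  highest levels i < j, these two form a 4-cycle with one vertex of the level below and one of the
  level above. Hence an induced tree has at most one vertex in each level strictly between, so at
  most (i + 1) + (2k - 1 - j) + (j - i - 1) = 2k - 1 vertices in total.
*)
theory Submission
  imports Defs
begin

text \<open>\<open>Max\<close> says nothing useful about an empty set, so some induced tree has to
  be exhibited: a single vertex, which is induced because there are no loops. Finiteness of the set
  of sizes comes from \<open>bound\<close>.\<close>

lemma max_induced_tree_le:
  fixes G :: "nat pair_pre_digraph"
  assumes G: "pair_graph G" and ne: "pverts G \<noteq> {}"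
    and bound: "\<And>H. induced_subgraph H (with_proj G) \<Longrightarrow> tree_graph H \<Longrightarrow> card (verts H) \<le> b"
  shows "max_induced_tree (with_proj G) \<le> b"
proof -
  interpret pair_graph G by (fact G)
  let ?M = "{card (verts H) | H. induced_subgraph H (with_proj G) \<and> tree_graph H}"
  obtain u where u: "u \<in> pverts G"
    using ne by auto
  let ?H = "with_proj \<lparr>pverts = {u}, parcs = {}\<rparr> :: (nat, nat \<times> nat) pre_digraph"
  have "pair_wf_digraph \<lparr>pverts = {u}, parcs = {}\<rparr>"
    by unfold_locales auto
  then have wf: "wf_digraph ?H"
    by unfold_locales auto
  have "induced_subgraph ?H (with_proj G)"
    using u wf wf_digraph_axioms pair_no_loops
    by (fastforce simp: induced_subgraph_def subgraph_def)
  moreover have "Digraph_Component.connected ?H"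
    by (auto simp: connected_def strongly_connected_def mk_symmetric_def reachable_def)
  moreover have "acyclic_graph ?H"
    by (auto simp: acyclic_graph_def pre_digraph.cycle_def pre_digraph.awalk_def)
  ultimately have "?M \<noteq> {}"
    unfolding tree_graph_def by blast
  moreover have "?M \<subseteq> {..b}"
    using bound by auto
  ultimately show ?thesis
    unfolding max_induced_tree_def using finite_subset[of ?M "{..b}"] by (intro Max.boundedI) auto
qed

text \<open>\<open>Min\<close> ranges over infinitely many graphs, since the vertex sets are
  arbitrary sets of naturals. The set of values is still finite, as an induced tree has at most
  \<open>n\<close> vertices.\<close>

lemma f_B_le_max_induced_tree:
  fixes G :: "nat pair_pre_digraph"
  assumes "pair_graph G" and "card (pverts G) = n"
    and "Digraph_Component.connected (with_proj G)" and "bipartite (with_proj G)"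
  shows "f_B n \<le> max_induced_tree (with_proj G)"
proof -
  let ?M = "{max_induced_tree (with_proj G) | G :: nat pair_pre_digraph.
     pair_graph G \<and> card (pverts G) = n \<and>
     Digraph_Component.connected (with_proj G) \<and> bipartite (with_proj G)}"
  have "max_induced_tree (with_proj G) \<le> n"
    if G: "pair_graph G" and n: "card (pverts G) = n" and con: "Digraph_Component.connected (with_proj G)"
    for G :: "nat pair_pre_digraph"
  proof (rule max_induced_tree_le[OF G])
    show "pverts G \<noteq> {}"
      using con by (auto simp: connected_def strongly_connected_def mk_symmetric_def)
    fix H :: "(nat, nat \<times> nat) pre_digraph"
    assume "induced_subgraph H (with_proj G)"
    then have "verts H \<subseteq> pverts G"
      by (auto simp: induced_subgraph_def subgraph_def)
    then show "card (verts H) \<le> n"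
      using G n by (metis card_mono pair_graph.axioms(1) pair_digraph.axioms(1)
          pair_fin_digraph.pair_finite_verts)
  qed
  then have "?M \<subseteq> {..n}"
    by auto
  then have "finite ?M"
    by (rule finite_subset) simp
  then show ?thesis
    unfolding f_B_def using assms by (intro Min_le) auto
qed

section \<open>Layered graphs: blow-ups of paths\<close>

definition layered_graph :: "'a set \<Rightarrow> ('a \<Rightarrow> nat) \<Rightarrow> 'a pair_pre_digraph" where
  "layered_graph V L =
     \<lparr>pverts = V, parcs = {(u, v) \<in> V \<times> V. L u = Suc (L v) \<or> L v = Suc (L u)}\<rparr>"

lemma pverts_layered_graph [simp]: "pverts (layered_graph V L) = V"
  by (simp add: layered_graph_def)

lemma parcs_layered_graph [simp]:
  "(u, v) \<in> parcs (layered_graph V L) \<longleftrightarrow>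
     u \<in> V \<and> v \<in> V \<and> (L u = Suc (L v) \<or> L v = Suc (L u))"
  by (auto simp: layered_graph_def)

lemma pair_graph_layered_graph:
  assumes "finite V"
  shows "pair_graph (layered_graph V L)"
proof -
  have "parcs (layered_graph V L) \<subseteq> V \<times> V"
    by auto
  then have "finite (parcs (layered_graph V L))"
    using assms by (meson finite_SigmaI finite_subset)
  then show ?thesis
    using assms by unfold_locales (auto simp: symmetric_def sym_def)
qed

lemma bipartite_layered_graph: "bipartite (with_proj (layered_graph V L))"
  unfolding bipartite_def
proof (intro exI conjI)
  show "{v \<in> V. even (L v)} \<union> {v \<in> V. odd (L v)} = verts (with_proj (layered_graph V L))"
    by auto
qed auto

text \<open>Repeated descent by one level can only stop at \<open>r\<close>, so every vertex reaches
  \<open>r\<close>; symmetry of the arcs then joins any two vertices through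
  \<open>r\<close>.\<close>

lemma connected_layered_graph:
  assumes fin: "finite V" and r: "r \<in> V"
    and descend: "\<And>v. v \<in> V \<Longrightarrow> v \<noteq> r \<Longrightarrow> \<exists>w \<in> V. L v = Suc (L w)"
  shows "Digraph_Component.connected (with_proj (layered_graph V L))"
proof -
  interpret pair_graph "layered_graph V L"
    using fin by (rule pair_graph_layered_graph)
  have to_r: "reachable (with_proj (layered_graph V L)) v r" if "v \<in> V" for v
    using that
  proof (induction "L v" arbitrary: v rule: less_induct)
    case less
    show ?case
    proof (cases "v = r")
      case False
      then obtain w where w: "w \<in> V" "L v = Suc (L w)"
        using descend less.prems by blast
      then have "(v, w) \<in> parcs (layered_graph V L)"
        using less.prems by simp
      then show ?thesis
        using less.hyps[of w] w by (auto intro: adj_reachable_trans)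
    qed (use r in auto)
  qed
  show ?thesis
  proof (rule connectedI)
    fix u v
    assume "u \<in> pverts (layered_graph V L)" "v \<in> pverts (layered_graph V L)"
    then show "reachable (with_proj (mk_symmetric (with_proj (layered_graph V L)))) u v"
      using to_r symmetric_reachable' reachable_trans reachable_mk_symmetricI by (metis pverts_layered_graph)
  qed (use r in auto)
qed

text \<open>A discrete intermediate value theorem: a walk climbs at most one level per arc, so it
  cannot jump over level \<open>l\<close>.\<close>

lemma reachable_hits_level:
  fixes L :: "'a \<Rightarrow> nat"
  assumes "reachable H u v"
    and step: "\<And>x y. (x, y) \<in> arcs_ends H \<Longrightarrow> L y \<le> Suc (L x)"
    and "L u \<le> l" "l \<le> L v"
  shows "\<exists>x \<in> verts H. L x = l"
  using assms(1,4) unfolding reachable_def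
proof (induction rule: rtrancl_on_induct)
  case base
  then show ?case
    using assms(3) by force
next
  case (step v w)
  then show ?case
    using assms(2)[of v w] by (cases "l \<le> L v") (auto simp: le_Suc_eq)
qed

lemma connected_hits_level:
  assumes H: "induced_subgraph H (with_proj (layered_graph V L))"
    and con: "Digraph_Component.connected H"
    and "u \<in> verts H" "v \<in> verts H" "L u \<le> l" "l \<le> L v"
  shows "\<exists>x \<in> verts H. L x = l"
proof -
  have ends: "tail H = fst" "head H = snd" "arcs H \<subseteq> parcs (layered_graph V L)"
    using H by (auto simp: induced_subgraph_def subgraph_def compatible_def)
  have "\<exists>x \<in> verts (with_proj (mk_symmetric H)). L x = l"
  proof (rule reachable_hits_level)
    show "reachable (with_proj (mk_symmetric H)) u v"
      using con assms(3,4) by (auto simp: connected_def strongly_connected_def mk_symmetric_def)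
    \<comment> \<open>Connectedness is defined by walks in the symmetric closure; reversing an arc
      still changes the level by exactly one.\<close>
    show "L y \<le> Suc (L x)" if "(x, y) \<in> arcs_ends (with_proj (mk_symmetric H))" for x y
      using that ends by (auto simp: mk_symmetric_def layered_graph_def)
  qed fact+
  then show ?thesis
    by (simp add: mk_symmetric_def)
qed

lemma induced_tree_inner_level_unique:
  assumes H: "induced_subgraph H (with_proj (layered_graph V L))" and tree: "tree_graph H"
    and a: "a \<in> verts H" "L a < L u" and b: "b \<in> verts H" "L u < L b"
    and uv: "u \<in> verts H" "v \<in> verts H" "L u = L v"
  shows "u = v"
proof (rule ccontr)
  assume "u \<noteq> v"
  have con: "Digraph_Component.connected H" and acyc: "acyclic_graph H"
    using tree by (auto simp: tree_graph_def)
  \<comment> \<open>Since \<open>L a < L u\<close>, the natural subtraction is not truncated and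
    \<open>x\<close> lies one level below \<open>u\<close> and \<open>v\<close>.\<close>
  obtain x where x: "x \<in> verts H" "L x = L u - 1"
    using connected_hits_level[OF H con a(1) uv(1), of "L u - 1"] a(2) by fastforce
  obtain y where y: "y \<in> verts H" "L y = Suc (L u)"
    using connected_hits_level[OF H con uv(1) b(1), of "Suc (L u)"] b(2) by auto
  have "verts H \<subseteq> V"
    using H by (auto simp: induced_subgraph_def subgraph_def)
  moreover have ends: "tail H = fst" "head H = snd"
    using H by (auto simp: induced_subgraph_def subgraph_def compatible_def)
  \<comment> \<open>Consecutive levels are completely joined and \<open>H\<close> is induced, so it
    inherits all these arcs.\<close>
  ultimately have "{(x, u), (u, y), (y, v), (v, x)} \<subseteq> arcs H"
    using H x y uv a(2) by (auto simp: induced_subgraph_def)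
  then have "pre_digraph.cycle H [(x, u), (u, y), (y, v), (v, x)]"
    using x y uv a(2) \<open>u \<noteq> v\<close>
    by (auto simp: pre_digraph.cycle_def pre_digraph.awalk_def pre_digraph.cas.simps
        pre_digraph.awalk_verts.simps ends)
  then show False
    using acyc by (fastforce simp: acyclic_graph_def)
qed

section \<open>Counting vertices level by level\<close>

lemma card_eq_sum_levels:
  fixes L :: "'a \<Rightarrow> nat"
  assumes "finite S" and "\<And>v. v \<in> S \<Longrightarrow> L v \<in> I" and "finite I"
  shows "card S = (\<Sum>l\<in>I. card {v \<in> S. L v = l})"
  using assms sum.group[of S I L "\<lambda>_. 1 :: nat"] by (simp add: image_subset_iff)

lemma card_le_of_level_bounds:
  fixes L :: "'a \<Rightarrow> nat"
  assumes fin: "finite S" and k: "0 < k"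
    and low: "\<And>l. card {v \<in> S. L v = l} \<le> Suc l"
    and high: "\<And>l. card {v \<in> S. L v = l} \<le> 2 * k - 1 - l"
    and inner: "\<And>a b u v. a \<in> S \<Longrightarrow> b \<in> S \<Longrightarrow> u \<in> S \<Longrightarrow> v \<in> S \<Longrightarrow>
      L a < L u \<Longrightarrow> L u < L b \<Longrightarrow> L u = L v \<Longrightarrow> u = v"
  shows "card S \<le> 2 * k - 1"
proof (cases "S = {}")
  case False
  define i where "i = Min (L ` S)"
  define j where "j = Max (L ` S)"
  have "i \<in> L ` S" "j \<in> L ` S"
    unfolding i_def j_def using fin False by auto
  then obtain a b where a: "a \<in> S" "L a = i" and b: "b \<in> S" "L b = j"
    by auto
  have range: "L v \<in> {i..j}" if "v \<in> S" for v
    unfolding i_def j_def using that fin by auto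
  then have ij: "i \<le> j"
    using a by auto
  have cS: "card S = (\<Sum>l\<in>{i..j}. card {v \<in> S. L v = l})"
    using fin range by (intro card_eq_sum_levels) auto
  \<comment> \<open>A nonempty top level forces \<open>j < 2 * k - 1\<close> by \<open>high\<close>.
    Hence \<open>2 * k - 1 - j\<close> is a true difference, and the three contributions in the last
    step cancel to \<open>2 * k - 1\<close>.\<close>
  have nz: "card {v \<in> S. L v = j} \<noteq> 0"
    using b fin by auto
  show ?thesis
  proof (cases "i = j")
    case True
    then show ?thesis
      using cS high[of j] by simp
  next
    case False
    then have "{i..j} = insert i (insert j {i<..<j})"
      using ij by auto
    then have "card S = card {v \<in> S. L v = i} + card {v \<in> S. L v = j}
        + (\<Sum>l\<in>{i<..<j}. card {v \<in> S. L v = l})"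
      using cS False by simp
    also have "(\<Sum>l\<in>{i<..<j}. card {v \<in> S. L v = l}) \<le> (\<Sum>l\<in>{i<..<j}. 1)"
    proof (rule sum_mono)
      fix l
      assume "l \<in> {i<..<j}"
      then show "card {v \<in> S. L v = l} \<le> 1"
        using inner[OF a(1) b(1)] a(2) b(2) fin by (auto simp: card_le_Suc0_iff_eq)
    qed
    finally show ?thesis
      using low[of i] high[of j] nz ij False by simp
  qed
qed simp

section \<open>Antidiagonals of a board numbered row by row\<close>

definition diagonal :: "nat \<Rightarrow> nat \<Rightarrow> nat" where
  "diagonal k v = v div k + v mod k"

text \<open>Cell \<open>v\<close> has row \<open>v div k\<close> and column \<open>v mod k\<close>.
  On a fixed antidiagonal the row determines the column, so cells can be counted by their
  rows.\<close>

lemma inj_on_div_diagonal: "inj_on (\<lambda>v. v div k) {v \<in> A. diagonal k v = l}"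
proof (rule inj_onI)
  fix x y
  assume "x \<in> {v \<in> A. diagonal k v = l}" "y \<in> {v \<in> A. diagonal k v = l}" and q: "x div k = y div k"
  then have "x mod k = y mod k"
    by (auto simp: diagonal_def)
  then show "x = y"
    using q by (metis div_mult_mod_eq)
qed

lemma card_diagonal:
  assumes S: "S \<subseteq> {..<k * k}"
  shows "card {v \<in> S. diagonal k v = l} \<le> Suc l"
    and "card {v \<in> S. diagonal k v = l} \<le> 2 * k - 1 - l"
proof -
  have "card {v \<in> S. diagonal k v = l} \<le> card {..l}"
    by (rule card_inj_on_le[OF inj_on_div_diagonal]) (auto simp: diagonal_def)
  then show "card {v \<in> S. diagonal k v = l} \<le> Suc l"
    by simp
  have "v div k < k" "l \<le> v div k + (k - 1)" if "v \<in> S" "diagonal k v = l" for v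
  proof -
    have v: "v < k * k"
      using S that by auto
    then show "v div k < k"
      by (simp add: less_mult_imp_div_less)
    from v have "v mod k < k"
      by (cases k) auto
    then show "l \<le> v div k + (k - 1)"
      using that by (auto simp: diagonal_def)
  qed
  \<comment> \<open>Columns are at most \<open>k - 1\<close>, so rows on antidiagonal
    \<open>l\<close> start at \<open>l - (k - 1)\<close>. If this truncates to 0, all
    \<open>k\<close> rows are allowed, and \<open>k\<close> is then at most
    \<open>2 * k - 1 - l\<close>.\<close>
  then have "(\<lambda>v. v div k) ` {v \<in> S. diagonal k v = l} \<subseteq> {l - (k - 1)..<k}"
    by fastforce
  then have "card {v \<in> S. diagonal k v = l} \<le> card {l - (k - 1)..<k}"
    by (intro card_inj_on_le[OF inj_on_div_diagonal]) auto
  then show "card {v \<in> S. diagonal k v = l} \<le> 2 * k - 1 - l"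
    by simp
qed

text \<open>Move one cell to the left or, from the first column, one cell up. Both moves decrease
  the cell number, so they stay inside \<open>{..<n}\<close> even when the board is only partly
  filled.\<close>

lemma diagonal_descend:
  assumes "0 < v" and "0 < k"
  shows "\<exists>w < v. diagonal k v = Suc (diagonal k w)"
proof (cases "v mod k = 0")
  case True
  then obtain q where q: "v = k * q"
    by auto
  with assms obtain p where "q = Suc p"
    by (cases q) auto
  with q assms show ?thesis
    by (intro exI[of _ "v - k"]) (auto simp: diagonal_def)
next
  case False
  then obtain r where r: "v mod k = Suc r"
    by (cases "v mod k") auto
  have "r < k"
    using r assms(2) by (metis Suc_lessD mod_less_divisor)
  moreover have v: "v = v div k * k + Suc r"
    using r by (metis div_mult_mod_eq)
  ultimately have "diagonal k (v div k * k + r) = v div k + r"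
    by (simp add: diagonal_def)
  then show ?thesis
    using r v by (intro exI[of _ "v div k * k + r"]) (auto simp: diagonal_def)
qed

lemma f_B_le:
  assumes n: "0 < n" and nk: "n \<le> k * k"
  shows "f_B n \<le> 2 * k - 1"
proof -
  let ?G = "layered_graph {..<n} (diagonal k)"
  have k: "0 < k"
    using n nk by (cases k) auto
  have "f_B n \<le> max_induced_tree (with_proj ?G)"
  proof (rule f_B_le_max_induced_tree)
    show "Digraph_Component.connected (with_proj ?G)"
    proof (rule connected_layered_graph)
      fix v
      assume v: "v \<in> {..<n}" "v \<noteq> 0"
      then obtain w where "w < v" "diagonal k v = Suc (diagonal k w)"
        using diagonal_descend[of v k] k by auto
      then show "\<exists>w \<in> {..<n}. diagonal k v = Suc (diagonal k w)"
        using v by (intro bexI[of _ w]) auto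
    qed (use n in auto)
  qed (auto simp: pair_graph_layered_graph bipartite_layered_graph)
  also have "\<dots> \<le> 2 * k - 1"
  proof (rule max_induced_tree_le)
    fix H
    assume H: "induced_subgraph H (with_proj ?G)" and tree: "tree_graph H"
    have sub: "verts H \<subseteq> {..<n}"
      using H by (auto simp: induced_subgraph_def subgraph_def)
    show "card (verts H) \<le> 2 * k - 1"
    proof (rule card_le_of_level_bounds)
      show "finite (verts H)"
        using sub finite_subset by blast
      show "card {v \<in> verts H. diagonal k v = l} \<le> Suc l"
        "card {v \<in> verts H. diagonal k v = l} \<le> 2 * k - 1 - l" for l
        using card_diagonal[of "verts H" k l] order_trans[OF sub, of "{..<k * k}"] nk by auto
    qed (use k induced_tree_inner_level_unique[OF H tree] in blast)+
  qed (use n in \<open>auto simp: pair_graph_layered_graph\<close>)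
  finally show ?thesis .
qed

lemma f_B_le_sqrt:
  assumes n: "0 < n"
  shows "real (f_B n) \<le> 2 * sqrt (real n) + 1"
proof -
  \<comment> \<open>The smallest board side that fits \<open>n\<close> cells; rounding up costs at
    most 1, so \<open>2 * k - 1\<close> exceeds \<open>2 * sqrt n\<close> by at most 1.\<close>
  define k where "k = nat \<lceil>sqrt (real n)\<rceil>"
  have "sqrt (real n) \<le> real k"
    unfolding k_def by (rule real_nat_ceiling_ge)
  then have "real n \<le> real k ^ 2"
    using sqrt_le_D by blast
  then have "n \<le> k * k"
    by (metis of_nat_le_iff of_nat_power power2_eq_square)
  then have "f_B n \<le> 2 * k - 1" and "0 < k"
    using f_B_le n by (auto intro: gr0I)
  then have "real (f_B n) \<le> 2 * real k - 1"
    by linarith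
  moreover have "real k \<le> sqrt (real n) + 1"
    unfolding k_def using n by (simp add: of_nat_ceiling)
  ultimately show ?thesis
    by linarith
qed

theorem mainTheorem2:
  shows "\<exists>\<epsilon> :: nat \<Rightarrow> real. \<epsilon> \<in> o(\<lambda>_. 1) \<and>
    (\<forall>\<^sub>F n in sequentially. real (f_B n) \<le> (2 + \<epsilon> n) * sqrt (real n))"
proof (intro exI conjI)
  \<comment> \<open>The error term is chosen so that its product with \<open>sqrt n\<close> is the
    additive constant 1 of \<open>f_B_le_sqrt\<close> for positive \<open>n\<close>.\<close>
  have "(\<lambda>n. 1 / sqrt (real n)) \<longlonglongrightarrow> 0"
    by (intro real_tendsto_divide_at_top[OF tendsto_const]
        filterlim_compose[OF sqrt_at_top filterlim_real_sequentially])
  then show "(\<lambda>n. 1 / sqrt (real n)) \<in> o(\<lambda>_. 1)"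
    by (intro smalloI_tendsto) auto
  show "\<forall>\<^sub>F n in sequentially. real (f_B n) \<le> (2 + 1 / sqrt (real n)) * sqrt (real n)"
    using eventually_gt_at_top[of 0]
  proof eventually_elim
    case (elim n)
    then show ?case
      using f_B_le_sqrt[of n] by (simp add: distrib_right)
  qed
qed

end
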